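(* Let $G$ be a finite simple graph and let $R$ and $C$ be subsets of $V(G)$ with $|R|=|C|$. Then $(R,C)$ is an immutable triangle of $G$ if and only if $V(G)\setminus C$ is a direct zero forcing set for $G$ from which $R$ can be the set of vertices that force.
   Context: A zero-nonzero pattern is a matrix with entries in $\{0,*\}$; a square pattern is a triangle if some permutation of its rows followed by some independent permutation of its columns yields a lower-triangular pattern with only $*$ entries on the diagonal. $\mathcal{S}_{\mathrm{znz}}(G)$ is the set of the $2^{|G|}$ symmetric $V(G)\times V(G)$ zero-nonzero patterns whose off-diagonal $(i,j)$ entry is $*$ exactly when $\{i,j\}\in E(G)$, with arbitrary diagonal. $(R,C)$ with $|R|=|C|$ is a persistent triangle of $G$ if $\mathcal A[R,C]$ is a triangle for every $\mathcal A\in\mathcal{S}_{\mathrm{znz}}(G)$; it is an immutable triangle if in addition $R\cap C=\emptyset$. Zero forcing rule: a filled vertex $v$ forces an unfilled vertex $u$ if $u$ is the only unfilled neighbor of $v$; each vertex forces at most once. A forcing sequence from $F$ is a sequence of forces each allowed when starting with $F$ filled after the previous forces; it is complete if no further force is possible afterwards. $F$ is a zero forcing set if repeated forcing fills all of $V(G)$. A zero forcing set $F$ is direct if there is a complete forcing sequence from $F$ in which every vertex that forces belongs to $F$. "$F$ is a direct zero forcing set from which $R$ can be the set of vertices that force" means $F$ is a direct zero forcing set and some complete forcing sequence from $F$ has exactly $R$ as its set of forcing vertices.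
   Formalization: The complete forcing sequence having R as its set of forcing vertices is also required to have every forcing vertex in V(G)∖C; with an arbitrary complete sequence the claim fails on the path a-b-c-d with C={b,c}, R={a,b}. *)

theory Defs
  imports "HOL-Library.FuncSet" "Graph_Theory.Pair_Digraph"
begin

text \<open>
  A finite simple graph is a \<open>pair_graph\<close>: a finite vertex set \<open>pverts G\<close> with a symmetric
  irreflexive arc relation \<open>parcs G\<close>, so \<open>{u, v}\<close> is an edge iff \<open>(u, v) \<in> parcs G\<close>.
\<close>

datatype znz = Zero | Star

type_synonym ('r, 'c) znz_pattern = "'r \<times> 'c \<Rightarrow> znz"

text \<open>
  \<open>triangle R C A\<close> says that the submatrix \<open>A[R,C]\<close> is a triangle. The lists of rows
  \<open>r 0, r 1, ...\<close> and of columns \<open>c 0, c 1, ...\<close> are the independent reorderings of the rows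
  and columns; only entries of \<open>A\<close> in \<open>R \<times> C\<close> are read.
\<close>

definition triangle :: "'r set \<Rightarrow> 'c set \<Rightarrow> ('r, 'c) znz_pattern \<Rightarrow> bool" where
  "triangle R C A \<longleftrightarrow> finite R \<and> finite C \<and> card R = card C \<and>
     (\<exists>r c. bij_betw r {..<card R} R \<and> bij_betw c {..<card C} C \<and>
        (\<forall>i<card R. A (r i, c i) = Star) \<and>
        (\<forall>i<card R. \<forall>j<card R. i < j \<longrightarrow> A (r i, c j) = Zero))"

text \<open>
  The extensional function space makes this a set of exactly \<open>2 ^ card (pverts G)\<close> patterns:
  values outside \<open>pverts G \<times> pverts G\<close> are fixed.
\<close>

definition S_znz :: "'a pair_pre_digraph \<Rightarrow> ('a, 'a) znz_pattern set" where
  "S_znz G = {A \<in> pverts G \<times> pverts G \<rightarrow>\<^sub>E UNIV.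
     (\<forall>i\<in>pverts G. \<forall>j\<in>pverts G. A (i, j) = A (j, i)) \<and>
     (\<forall>i\<in>pverts G. \<forall>j\<in>pverts G. i \<noteq> j \<longrightarrow> (A (i, j) = Star \<longleftrightarrow> (i, j) \<in> parcs G))}"

definition persistent_triangle :: "'a pair_pre_digraph \<Rightarrow> 'a set \<Rightarrow> 'a set \<Rightarrow> bool" where
  "persistent_triangle G R C \<longleftrightarrow> R \<subseteq> pverts G \<and> C \<subseteq> pverts G \<and> card R = card C \<and>
     (\<forall>A\<in>S_znz G. triangle R C A)"

definition immutable_triangle :: "'a pair_pre_digraph \<Rightarrow> 'a set \<Rightarrow> 'a set \<Rightarrow> bool" where
  "immutable_triangle G R C \<longleftrightarrow> persistent_triangle G R C \<and> R \<inter> C = {}"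

definition can_force :: "'a pair_pre_digraph \<Rightarrow> 'a set \<Rightarrow> 'a \<Rightarrow> 'a \<Rightarrow> bool" where
  "can_force G S v u \<longleftrightarrow> v \<in> S \<and> {w \<in> pverts G - S. (v, w) \<in> parcs G} = {u}"

text \<open>A list of pairs \<open>(v, u)\<close> records the successive forces of \<open>u\<close> by \<open>v\<close>.\<close>

definition filled_after :: "'a set \<Rightarrow> ('a \<times> 'a) list \<Rightarrow> 'a set" where
  "filled_after F fs = F \<union> snd ` set fs"

definition forcing_vertices :: "('a \<times> 'a) list \<Rightarrow> 'a set" where
  "forcing_vertices fs = fst ` set fs"

definition forcing_sequence :: "'a pair_pre_digraph \<Rightarrow> 'a set \<Rightarrow> ('a \<times> 'a) list \<Rightarrow> bool" where
  "forcing_sequence G F fs \<longleftrightarrow> distinct (map fst fs) \<and>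
     (\<forall>i<length fs. can_force G (filled_after F (take i fs)) (fst (fs ! i)) (snd (fs ! i)))"

definition complete_forcing_sequence :: "'a pair_pre_digraph \<Rightarrow> 'a set \<Rightarrow> ('a \<times> 'a) list \<Rightarrow> bool" where
  "complete_forcing_sequence G F fs \<longleftrightarrow> forcing_sequence G F fs \<and>
     \<not> (\<exists>v u. forcing_sequence G F (fs @ [(v, u)]))"

definition zero_forcing_set :: "'a pair_pre_digraph \<Rightarrow> 'a set \<Rightarrow> bool" where
  "zero_forcing_set G F \<longleftrightarrow> F \<subseteq> pverts G \<and>
     (\<exists>fs. forcing_sequence G F fs \<and> filled_after F fs = pverts G)"

definition direct_complete_forcing_sequence ::
    "'a pair_pre_digraph \<Rightarrow> 'a set \<Rightarrow> ('a \<times> 'a) list \<Rightarrow> bool" where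
  "direct_complete_forcing_sequence G F fs \<longleftrightarrow>
     complete_forcing_sequence G F fs \<and> forcing_vertices fs \<subseteq> F"

definition direct_zero_forcing_set :: "'a pair_pre_digraph \<Rightarrow> 'a set \<Rightarrow> bool" where
  "direct_zero_forcing_set G F \<longleftrightarrow> zero_forcing_set G F \<and>
     (\<exists>fs. direct_complete_forcing_sequence G F fs)"

text \<open>
  The sequence whose forcing vertices are \<open>R\<close> must itself witness that \<open>F\<close> is direct. On the path
  \<open>a, b, c, d\<close> the set \<open>F = {a, d}\<close> is direct (\<open>a\<close> forces \<open>b\<close>, \<open>d\<close> forces \<open>c\<close>), but the complete
  sequence \<open>a\<close> forces \<open>b\<close>, \<open>b\<close> forces \<open>c\<close> has forcing vertices \<open>{a, b}\<close>, which meets the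
  complement \<open>{b, c}\<close> of \<open>F\<close>; \<open>({a, b}, {b, c})\<close> is not an immutable triangle.
\<close>

definition direct_zero_forcing_set_with :: "'a pair_pre_digraph \<Rightarrow> 'a set \<Rightarrow> 'a set \<Rightarrow> bool" where
  "direct_zero_forcing_set_with G F R \<longleftrightarrow> direct_zero_forcing_set G F \<and>
     (\<exists>fs. direct_complete_forcing_sequence G F fs \<and> forcing_vertices fs = R)"

end

theory Submission
  imports Defs
begin

text \<open>
  For disjoint \<open>R\<close> and \<open>C\<close> the entries of \<open>A[R,C]\<close> are off-diagonal, hence the same for every
  pattern \<open>A\<close> of \<open>G\<close>. A lower-triangular ordering with rows \<open>r i\<close> and columns \<open>c i\<close> then says
  that \<open>c i\<close> is the only neighbour of \<open>r i\<close> among \<open>c i\<close>, \<open>c (i + 1)\<close>, \<open>\<dots>\<close>, that is, that \<open>r i\<close>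
  forces \<open>c i\<close> at step \<open>i\<close> when starting from the complement of \<open>C\<close>.
\<close>

text \<open>Provides an instance for the universal quantifier in \<open>persistent_triangle\<close>,
  from which an actual ordering of rows and columns can be read off.\<close>

lemma S_znz_nonempty:
  assumes "pair_graph G"
  shows "S_znz G \<noteq> {}"
proof -
  interpret pair_graph G by fact
  let ?A = "restrict (\<lambda>p. if p \<in> parcs G then Star else Zero) (pverts G \<times> pverts G)"
  have "(i, j) \<in> parcs G \<longleftrightarrow> (j, i) \<in> parcs G" for i j
    using arcs_symmetric by blast
  then have "?A \<in> S_znz G"
    unfolding S_znz_def by auto
  then show ?thesis by blast
qed

lemma S_znz_Star_iff:
  assumes "A \<in> S_znz G" "i \<in> pverts G" "j \<in> pverts G" "i \<noteq> j"
  shows "A (i, j) = Star \<longleftrightarrow> (i, j) \<in> parcs G"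
  using assms by (simp add: S_znz_def)

lemma forcing_sequence_can_force:
  assumes "forcing_sequence G F fs" "i < length fs"
  shows "can_force G (F \<union> snd ` set (take i fs)) (fst (fs ! i)) (snd (fs ! i))"
  using assms by (simp add: forcing_sequence_def filled_after_def)

lemma forcing_sequence_target_unfilled:
  assumes "forcing_sequence G F fs" "i < length fs"
  shows "snd (fs ! i) \<in> pverts G - (F \<union> snd ` set (take i fs))"
  using forcing_sequence_can_force[OF assms] unfolding can_force_def by blast

text \<open>A target is unfilled when it is forced and stays filled from then on, so it cannot be
  forced again.\<close>

lemma forcing_sequence_distinct_targets:
  assumes "forcing_sequence G F fs"
  shows "distinct (map snd fs)"
proof -
  have less: "snd (fs ! i) \<noteq> snd (fs ! j)" if "i < j" "j < length fs" for i j
  proof -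
    have "fs ! i \<in> set (take j fs)"
      using that by (auto simp: in_set_conv_nth)
    then show ?thesis
      using forcing_sequence_target_unfilled[OF assms that(2)] by (metis DiffD2 UnI2 imageI)
  qed
  show ?thesis
    unfolding distinct_conv_nth
  proof (intro allI impI)
    fix i j assume "i < length (map snd fs)" "j < length (map snd fs)" "i \<noteq> j"
    then show "map snd fs ! i \<noteq> map snd fs ! j"
      using less[of i j] less[of j i] by (cases i j rule: linorder_cases) auto
  qed
qed

lemma bij_betw_nth_map:
  assumes "distinct (map f xs)" "f ` set xs = S" "n = length xs"
  shows "bij_betw (\<lambda>i. f (xs ! i)) {..<n} S"
proof -
  have "bij_betw (\<lambda>i. map f xs ! i) {..<n} S"
    using assms by (intro bij_betw_nth) auto
  then show ?thesis
    by (rule bij_betw_cong[THEN iffD1, rotated]) (simp add: assms(3))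
qed

lemma forcing_sequence_of_triangle:
  assumes A: "A \<in> S_znz G" and tri: "triangle R C A"
    and R: "R \<subseteq> pverts G" and C: "C \<subseteq> pverts G" and disj: "R \<inter> C = {}"
  obtains fs where "forcing_sequence G (pverts G - C) fs"
    "fst ` set fs = R" "snd ` set fs = C"
proof -
  obtain r c where r: "bij_betw r {..<card R} R" and c: "bij_betw c {..<card R} C"
    and diag: "\<And>i. i < card R \<Longrightarrow> A (r i, c i) = Star"
    and upper: "\<And>i j. \<lbrakk>j < card R; i < j\<rbrakk> \<Longrightarrow> A (r i, c j) = Zero"
    using tri unfolding triangle_def by (auto dest: order.strict_trans)
  have rR: "r i \<in> R" and cC: "c i \<in> C" if "i < card R" for i
    using that r c by (auto simp: bij_betw_def)
  have arc: "(x, y) \<in> parcs G \<longleftrightarrow> A (x, y) = Star" if "x \<in> R" "y \<in> C" for x y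
    using that R C disj by (intro S_znz_Star_iff[OF A, symmetric]) auto
  define fs where "fs = map (\<lambda>i. (r i, c i)) [0..<card R]"
  have fsts: "fst ` set fs = R" and snds: "snd ` set fs = C"
    using r c by (auto simp: fs_def bij_betw_def image_image atLeast0LessThan)
  have "forcing_sequence G (pverts G - C) fs"
    unfolding forcing_sequence_def
  proof (intro conjI allI impI)
    show "distinct (map fst fs)"
      using r by (auto simp: fs_def distinct_map bij_betw_def atLeast0LessThan comp_def)
    fix i assume "i < length fs"
    then have i: "i < card R" by (simp add: fs_def)
    have filled: "filled_after (pverts G - C) (take i fs) = pverts G - C \<union> c ` {..<i}"
      using i by (simp add: filled_after_def fs_def take_map image_image atLeast0LessThan)
    \<comment> \<open>The vertices still unfilled at step \<open>i\<close> are the columns from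
      \<open>c i\<close> onwards: surjectivity of \<open>c\<close> gives one direction, injectivity
      the other.\<close>
    have later: "w \<in> C - c ` {..<i} \<longleftrightarrow> (\<exists>j. i \<le> j \<and> j < card R \<and> w = c j)" for w
    proof
      assume w: "w \<in> C - c ` {..<i}"
      then obtain j where "j < card R" "w = c j"
        using c by (auto simp: bij_betw_def)
      then show "\<exists>j. i \<le> j \<and> j < card R \<and> w = c j"
        using w by (auto simp: not_less[symmetric])
    next
      assume "\<exists>j. i \<le> j \<and> j < card R \<and> w = c j"
      then show "w \<in> C - c ` {..<i}"
        using c cC i unfolding bij_betw_def inj_on_def by fastforce
    qed
    have "pverts G - (pverts G - C \<union> c ` {..<i}) = C - c ` {..<i}"
      using C by blast
    \<comment> \<open>The diagonal \<open>Star\<close> makes \<open>c i\<close> a neighbour of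
      \<open>r i\<close>; the zeros to its right exclude every later column.\<close>
    moreover have "{w \<in> C - c ` {..<i}. (r i, w) \<in> parcs G} = {c i}"
      using later i arc[OF rR cC] diag upper by (auto simp: order.order_iff_strict)
    \<comment> \<open>The forcing vertex \<open>r i\<close> is filled from the start, because
      \<open>R\<close> avoids \<open>C\<close>.\<close>
    ultimately show "can_force G (filled_after (pverts G - C) (take i fs)) (fst (fs ! i)) (snd (fs ! i))"
      using i rR[OF i] R disj unfolding filled can_force_def by (auto simp: fs_def)
  qed
  then show thesis using fsts snds that by blast
qed

lemma triangle_of_forcing_sequence:
  assumes fs: "forcing_sequence G (pverts G - C) fs"
    and fsts: "fst ` set fs = R" and snds: "snd ` set fs = C"
    and disj: "R \<inter> C = {}" and R: "R \<subseteq> pverts G" and C: "C \<subseteq> pverts G" and A: "A \<in> S_znz G"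
  shows "triangle R C A"
proof -
  let ?r = "\<lambda>i. fst (fs ! i)" and ?c = "\<lambda>i. snd (fs ! i)"
  have dr: "distinct (map fst fs)" and dc: "distinct (map snd fs)"
    using fs forcing_sequence_distinct_targets by (auto simp: forcing_sequence_def)
  have cardR: "card R = length fs" and cardC: "card C = length fs"
    using distinct_card[OF dr] distinct_card[OF dc] fsts snds by auto
  have arc: "(x, y) \<in> parcs G \<longleftrightarrow> A (x, y) = Star" if "x \<in> R" "y \<in> C" for x y
    using that R C disj by (intro S_znz_Star_iff[OF A, symmetric]) auto
  have rR: "?r i \<in> R" and cC: "?c i \<in> C" if "i < length fs" for i
    using that fsts snds by auto
  have "A (?r i, ?c i) = Star" if "i < length fs" for i
    using forcing_sequence_can_force[OF fs that] arc[OF rR cC] that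
    unfolding can_force_def by blast
  moreover have "A (?r i, ?c j) = Zero" if "i < j" "j < length fs" for i j
  proof -
    \<comment> \<open>Filled sets only grow: a vertex unfilled just before step \<open>j\<close> was
      already unfilled at the earlier step \<open>i\<close>.\<close>
    have "?c j \<notin> snd ` set (take i fs)"
      using forcing_sequence_target_unfilled[OF fs that(2)] set_take_subset_set_take[of i j fs] that
      by auto
    moreover have "?c j \<noteq> ?c i"
      using dc that by (auto simp: distinct_conv_nth)
    \<comment> \<open>At step \<open>i\<close> the only unfilled neighbour of \<open>?r i\<close> is
      \<open>?c i\<close>, so the other unfilled vertex \<open>?c j\<close> is not adjacent to
      it.\<close>
    ultimately have "(?r i, ?c j) \<notin> parcs G"
      using forcing_sequence_can_force[OF fs, of i] cC[OF that(2)] C that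
      unfolding can_force_def by auto
    then show ?thesis
      using arc[OF rR cC] that by (cases "A (?r i, ?c j)") auto
  qed
  moreover have "bij_betw ?r {..<length fs} R" "bij_betw ?c {..<length fs} C"
    using dr dc fsts snds by (simp_all add: bij_betw_nth_map)
  moreover have "finite R" "finite C"
    using fsts snds by auto
  ultimately show ?thesis
    unfolding triangle_def cardR cardC
    by (intro conjI refl exI[of _ ?r] exI[of _ ?c]) auto
qed

text \<open>Any further force would need an unfilled target.\<close>

lemma filling_forcing_sequence_complete:
  assumes "forcing_sequence G F fs" "filled_after F fs = pverts G"
  shows "complete_forcing_sequence G F fs"
proof -
  have "\<not> forcing_sequence G F (fs @ [(v, u)])" for v u
    using forcing_sequence_target_unfilled[of G F "fs @ [(v, u)]" "length fs"] assms(2)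
    by (auto simp: filled_after_def)
  then show ?thesis
    using assms(1) by (simp add: complete_forcing_sequence_def)
qed

theorem theorem2p16:
  fixes G :: "'a pair_pre_digraph" and R C :: "'a set"
  assumes "pair_graph G"
    and "R \<subseteq> pverts G" and "C \<subseteq> pverts G" and "card R = card C"
  shows "immutable_triangle G R C \<longleftrightarrow> direct_zero_forcing_set_with G (pverts G - C) R"
proof
  assume imm: "immutable_triangle G R C"
  then have disj: "R \<inter> C = {}"
    by (simp add: immutable_triangle_def)
  \<comment> \<open>One pattern suffices here, since its entries on \<open>R \<times> C\<close>
    already record the arcs between \<open>R\<close> and \<open>C\<close>.\<close>
  obtain A where "A \<in> S_znz G"
    using S_znz_nonempty[OF assms(1)] by blast
  moreover from this have "triangle R C A"
    using imm by (simp add: immutable_triangle_def persistent_triangle_def)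
  ultimately obtain fs where fs: "forcing_sequence G (pverts G - C) fs"
    "fst ` set fs = R" "snd ` set fs = C"
    using forcing_sequence_of_triangle assms(2,3) disj by blast
  have filled: "filled_after (pverts G - C) fs = pverts G"
    using fs(3) assms(3) by (auto simp: filled_after_def)
  have "direct_complete_forcing_sequence G (pverts G - C) fs"
    using filling_forcing_sequence_complete[OF fs(1) filled] fs(2) assms(2) disj
    by (auto simp: direct_complete_forcing_sequence_def forcing_vertices_def)
  then show "direct_zero_forcing_set_with G (pverts G - C) R"
    using fs filled
    unfolding direct_zero_forcing_set_with_def direct_zero_forcing_set_def
      zero_forcing_set_def forcing_vertices_def by blast
next
  interpret pair_graph G by fact
  assume "direct_zero_forcing_set_with G (pverts G - C) R"
  \<comment> \<open>Directness of this particular sequence puts \<open>R\<close> inside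
    \<open>pverts G - C\<close>, which is the disjointness of \<open>R\<close> and
    \<open>C\<close>.\<close>
  then obtain fs where fs: "forcing_sequence G (pverts G - C) fs"
    and fsts: "fst ` set fs = R" and sub: "R \<subseteq> pverts G - C"
    unfolding direct_zero_forcing_set_with_def direct_complete_forcing_sequence_def
      complete_forcing_sequence_def forcing_vertices_def by blast
  \<comment> \<open>Each vertex forces at most once and is forced at most once, so both sides equal
    \<open>length fs\<close>.\<close>
  have "card (snd ` set fs) = card (fst ` set fs)"
    using distinct_card[OF forcing_sequence_distinct_targets[OF fs]] fs
      distinct_card[of "map fst fs"] by (auto simp: forcing_sequence_def)
  moreover have "snd ` set fs \<subseteq> C"
    using forcing_sequence_target_unfilled[OF fs] by (fastforce simp: in_set_conv_nth)
  \<comment> \<open>As \<open>card R = card C\<close>, counting shows that all of \<open>C\<close> gets filled;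
    that \<open>pverts G - C\<close> is a zero forcing set does not determine what \<open>fs\<close> fills.\<close>
  ultimately have "snd ` set fs = C"
    using fsts assms(3,4) finite_subset[OF assms(3)] by (simp add: card_subset_eq)
  then show "immutable_triangle G R C"
    using triangle_of_forcing_sequence[OF fs fsts] sub assms(2-4)
    unfolding immutable_triangle_def persistent_triangle_def by blast
qed

end
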